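(* Let $X$ be a Banach space, let $\mathcal{S}=\{S_1,\dots,S_m\}$ and $\mathcal{T}=\{T_1,\dots,T_m\}$ be systems of contractions of $X$, and let $q=\max_i\max(\operatorname{Lip}S_i,\operatorname{Lip}T_i)$. Let $\varphi:I^\infty\to K$ and $\psi:I^\infty\to L$ be the index maps for the attractors $K$ of $\mathcal{S}$ and $L$ of $\mathcal{T}$. Let $V\subset X$ be a nonempty bounded set such that $S_i(V)\subset V$ and $T_i(V)\subset V$ for every $i=1,\dots,m$. For an index $i$ or a multiindex $\mathbf{j}$ put $\Delta_i(x)=T_i(x)-S_i(x)$ and $\Delta_{\mathbf{j}}(x)=T_{\mathbf{j}}(x)-S_{\mathbf{j}}(x)$, and suppose that $\|\Delta_i(x)\|\le\delta$ for every $i=1,\dots,m$ and every $x\in V$. Then: (B1) If for some multiindex $\mathbf{j}$ and reals $\delta_1,\delta_2$ one has $\delta_1<\|\Delta_{\mathbf{j}}(x)\|<\delta_2$ for all $x\in V$, and $\delta_1>\dfrac{q_{\mathbf{j}}\delta}{1-q}$, then for every $\sigma\in\mathbf{j}I^\infty$, $$\delta_1-\frac{q_{\mathbf{j}}\delta}{1-q}\le\|\psi(\sigma)-\varphi(\sigma)\|\le\delta_2+\frac{q_{\mathbf{j}}\delta}{1-q}.$$ (B2) If for some multiindices $\mathbf{i},\mathbf{j}$ and reals $\delta_1,\delta_2$ one has $\delta_1<\|\Delta_{\mathbf{i}}(x)-\Delta_{\mathbf{j}}(y)\|<\delta_2$ for all $x,y\in V$, and $\delta_1>\dfrac{(q_{\mathbf{i}}+q_{\mathbf{j}})\delta}{1-q}$,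 then for every $\sigma\in\mathbf{i}I^\infty$ and $\tau\in\mathbf{j}I^\infty$, $$\delta_1-\frac{(q_{\mathbf{i}}+q_{\mathbf{j}})\delta}{1-q}\le\|\psi(\sigma)-\varphi(\sigma)-\psi(\tau)+\varphi(\tau)\|\le\delta_2+\frac{(q_{\mathbf{i}}+q_{\mathbf{j}})\delta}{1-q}.$$
   Context: A contraction is a map with Lipschitz constant $\operatorname{Lip}<1$. The attractor of a system $\{S_1,\dots,S_m\}$ of contractions is the unique nonempty compact set $K$ with $K=\bigcup_i S_i(K)$. $I=\{1,\dots,m\}$ and $I^\infty$ is the set of infinite sequences in $I$. A multiindex is a finite word $\mathbf{j}=j_1\dots j_k$ in $I$; $S_{\mathbf{j}}=S_{j_1}\circ\dots\circ S_{j_k}$, $T_{\mathbf{j}}=T_{j_1}\circ\dots\circ T_{j_k}$, and $q_{\mathbf{j}}=q_{j_1}\cdots q_{j_k}$ with $q_i=\operatorname{Lip}S_i$. $\mathbf{j}I^\infty$ is the set of sequences in $I^\infty$ beginning with the word $\mathbf{j}$. The index map of $\mathcal{S}$ sends $\sigma=i_1i_2i_3\dots$ to the limit $\varphi(\sigma)=\lim_{n\to\infty}S_{i_1\dots i_n}(x)$, which is independent of $x\in X$; likewise $\psi$ for $\mathcal{T}$. *)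

theory Defs
  imports "HOL-Analysis.Analysis" "HOL-Library.Stream"
begin

text \<open>The infimum (rather than a supremum of difference quotients) also gives the
  value \<open>0\<close> on the trivial space. It is meaningful only for Lipschitz maps.\<close>

definition Lip :: "('a::metric_space \<Rightarrow> 'b::metric_space) \<Rightarrow> real" where
  "Lip f = Inf {C. C-lipschitz_on UNIV f}"

definition contraction :: "('a::metric_space \<Rightarrow> 'a) \<Rightarrow> bool" where
  "contraction f \<longleftrightarrow> (\<exists>C. C-lipschitz_on UNIV f) \<and> Lip f < 1"

definition is_attractor :: "'i set \<Rightarrow> ('i \<Rightarrow> 'a::topological_space \<Rightarrow> 'a) \<Rightarrow> 'a set \<Rightarrow> bool" where
  "is_attractor I S K \<longleftrightarrow> K \<noteq> {} \<and> compact K \<and> K = (\<Union>i\<in>I. S i ` K)"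

text \<open>\<open>word_map S [j\<^sub>1, \<dots>, j\<^sub>k] = S j\<^sub>1 \<circ> \<dots> \<circ> S j\<^sub>k\<close>; the empty word gives the identity.\<close>

definition word_map :: "('i \<Rightarrow> 'a \<Rightarrow> 'a) \<Rightarrow> 'i list \<Rightarrow> 'a \<Rightarrow> 'a" where
  "word_map S w = foldr S w"

definition word_ratio :: "('i \<Rightarrow> 'a::metric_space \<Rightarrow> 'a) \<Rightarrow> 'i list \<Rightarrow> real" where
  "word_ratio S w = (\<Prod>i\<leftarrow>w. Lip (S i))"

definition cylinder :: "'i set \<Rightarrow> 'i list \<Rightarrow> 'i stream set" where
  "cylinder I w = {\<sigma> \<in> streams I. stake (length w) \<sigma> = w}"

text \<open>For finitely many contractions the limit exists and does not depend on \<open>x\<close>;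
  see \<open>index_map_tendsto\<close> below.\<close>

definition index_map :: "('i \<Rightarrow> 'a::topological_space \<Rightarrow> 'a) \<Rightarrow> 'i stream \<Rightarrow> 'a" where
  "index_map S \<sigma> = (THE p. \<forall>x. (\<lambda>n. word_map S (stake n \<sigma>) x) \<longlonglongrightarrow> p)"

lemma contraction_lipschitz:
  assumes "contraction f"
  obtains C where "C < 1" "C-lipschitz_on UNIV f"
proof -
  have "{C. C-lipschitz_on UNIV f} \<noteq> {}" "Inf {C. C-lipschitz_on UNIV f} < 1"
    using assms by (auto simp: contraction_def Lip_def)
  from cInf_lessD[OF this] that show ?thesis by auto
qed

lemma contractions_uniform:
  assumes "finite I" "\<And>i. i \<in> I \<Longrightarrow> contraction (S i)"
  shows "\<exists>q. 0 \<le> q \<and> q < 1 \<and> (\<forall>i\<in>I. q-lipschitz_on UNIV (S i))"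
  using assms
proof (induction I rule: finite_induct)
  case empty
  show ?case by (rule exI[of _ 0]) auto
next
  case (insert i I)
  then obtain q where q: "0 \<le> q" "q < 1" "\<forall>i\<in>I. q-lipschitz_on UNIV (S i)" by auto
  obtain C where C: "C < 1" "C-lipschitz_on UNIV (S i)"
    using contraction_lipschitz insert.prems by blast
  show ?case
    using q C by (intro exI[of _ "max q C"]) (auto intro: lipschitz_on_mono)
qed

lemma word_map_dist:
  assumes "\<forall>i\<in>I. q-lipschitz_on UNIV (S i)" "set w \<subseteq> I" "0 \<le> q"
  shows "dist (word_map S w x) (word_map S w y) \<le> q ^ length w * dist x y"
  using assms(2)
proof (induction w)
  case Nil
  show ?case by (simp add: word_map_def)
next
  case (Cons i w)
  have "dist (word_map S (i # w) x) (word_map S (i # w) y)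
      \<le> q * dist (word_map S w x) (word_map S w y)"
    using assms(1) Cons.prems by (auto simp: word_map_def intro!: lipschitz_onD)
  also have "\<dots> \<le> q * (q ^ length w * dist x y)"
    using Cons assms(3) by (intro mult_left_mono) auto
  finally show ?case by (simp add: mult.assoc)
qed

lemma index_map_tendsto:
  fixes S :: "'i \<Rightarrow> 'a::banach \<Rightarrow> 'a"
  assumes "finite I" "\<And>i. i \<in> I \<Longrightarrow> contraction (S i)" "\<sigma> \<in> streams I"
  shows "(\<lambda>n. word_map S (stake n \<sigma>) x) \<longlonglongrightarrow> index_map S \<sigma>"
proof -
  obtain q where q: "0 \<le> q" "q < 1" "\<forall>i\<in>I. q-lipschitz_on UNIV (S i)"
    using contractions_uniform[where S = S, OF assms(1,2)] by blast
  have \<sigma>: "set (stake n \<sigma>) \<subseteq> I" "\<sigma> !! n \<in> I" for n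
    using assms(3) by (auto simp: streams_iff_snth set_conv_nth)
  define f where "f y n = word_map S (stake n \<sigma>) y" for y n
  define D where "D = (\<Sum>i\<in>I. dist (S i 0) 0)"
  have step: "norm (f 0 (Suc n) - f 0 n) \<le> q ^ n * D" for n
  proof -
    have "f 0 (Suc n) = word_map S (stake n \<sigma>) (S (\<sigma> !! n) 0)"
      unfolding f_def word_map_def by (simp add: stake_Suc del: stake.simps)
    then have "norm (f 0 (Suc n) - f 0 n) \<le> q ^ n * dist (S (\<sigma> !! n) 0) 0"
      using word_map_dist[OF q(3) \<sigma>(1)[of n] q(1), of "S (\<sigma> !! n) 0" 0]
      by (simp add: f_def dist_norm)
    also have "\<dots> \<le> q ^ n * D"
      using q(1) \<sigma>(2)[of n] assms(1) unfolding D_def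
      by (intro mult_left_mono member_le_sum) auto
    finally show ?thesis .
  qed
  have "summable (\<lambda>n. q ^ n * D)"
    using q by (intro summable_mult2 summable_geometric) auto
  then have "summable (\<lambda>n. f 0 (Suc n) - f 0 n)"
    by (rule summable_comparison_test') (rule step)
  then have "(\<lambda>n. f 0 n - f 0 0) \<longlonglongrightarrow> (\<Sum>n. f 0 (Suc n) - f 0 n)"
    using summable_LIMSEQ[of "\<lambda>n. f 0 (Suc n) - f 0 n"] by (simp only: sum_lessThan_telescope)
  from tendsto_add[OF this tendsto_const[of "f 0 0"]]
  obtain p where p: "f 0 \<longlonglongrightarrow> p" by simp
  have lim: "f y \<longlonglongrightarrow> p" for y
  proof -
    have "(\<lambda>n. q ^ n * dist y 0) \<longlonglongrightarrow> 0"
      using q by (intro tendsto_mult_left_zero LIMSEQ_power_zero) auto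
    moreover have "norm (f y n - f 0 n) \<le> q ^ n * dist y 0" for n
      using word_map_dist[OF q(3) \<sigma>(1)[of n] q(1), of y 0] by (simp add: f_def dist_norm)
    then have "\<forall>\<^sub>F n in sequentially. norm (f y n - f 0 n) \<le> q ^ n * dist y 0"
      by (intro always_eventually allI)
    ultimately have "(\<lambda>n. f y n - f 0 n) \<longlonglongrightarrow> 0"
      by (rule Lim_null_comparison[rotated])
    from tendsto_add[OF this p] show ?thesis by simp
  qed
  have "index_map S \<sigma> = p"
    unfolding index_map_def
    proof (rule the_equality)
    show "\<forall>x. (\<lambda>n. word_map S (stake n \<sigma>) x) \<longlonglongrightarrow> p"
      using lim by (simp add: f_def[abs_def])
    show "p' = p" if "\<forall>x. (\<lambda>n. word_map S (stake n \<sigma>) x) \<longlonglongrightarrow> p'" for p'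
      using that lim[of 0] LIMSEQ_unique unfolding f_def[abs_def] by blast
  qed
  with lim[of x] show ?thesis by (simp add: f_def[abs_def])
qed

lemma index_map_in_attractor:
  fixes S :: "'i \<Rightarrow> 'a::banach \<Rightarrow> 'a"
  assumes "finite I" "\<And>i. i \<in> I \<Longrightarrow> contraction (S i)" "is_attractor I S K" "\<sigma> \<in> streams I"
  shows "index_map S \<sigma> \<in> K"
proof -
  obtain x where x: "x \<in> K" and K: "compact K" "\<And>i y. i \<in> I \<Longrightarrow> y \<in> K \<Longrightarrow> S i y \<in> K"
    using assms(3) unfolding is_attractor_def by blast
  have "set w \<subseteq> I \<Longrightarrow> word_map S w x \<in> K" for w
    by (induction w) (auto simp: word_map_def x K)
  moreover have "set (stake n \<sigma>) \<subseteq> I" for n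
    using assms(4) by (auto simp: streams_iff_snth set_conv_nth)
  ultimately have "word_map S (stake n \<sigma>) x \<in> K" for n by blast
  then show ?thesis
    using index_map_tendsto[where S = S and x = x, OF assms(1,2,4)] K(1)
    by (meson closed_sequentially compact_imp_closed)
qed

end

theory Submission imports Defs begin

text \<open>
  Write \<open>\<Delta>\<^sub>w = T\<^sub>w - S\<^sub>w\<close>. Everything rests on the splitting
  \<open>\<Delta>\<^sub>j\<^sub>w(x) = \<Delta>\<^sub>j(y) + (S\<^sub>j(y) - S\<^sub>j(z))\<close> with \<open>y = T\<^sub>w(x)\<close> and \<open>z = S\<^sub>w(x)\<close>.
  The point \<open>y\<close> stays in \<open>V\<close>, so the hypotheses of (B1) and (B2) apply to \<open>\<Delta>\<^sub>j(y)\<close>. The second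
  summand is an error of norm at most \<open>q\<^sub>j \<parallel>y - z\<parallel>\<close>, and \<open>\<parallel>y - z\<parallel> \<le> \<delta> / (1 - q)\<close>: each letter of
  \<open>w\<close> adds at most \<open>\<delta>\<close> to the distance after shrinking it by the factor \<open>q\<close>, and \<open>\<delta> / (1 - q)\<close>
  is the fixed point of \<open>t \<mapsto> \<delta> + q t\<close> (lemma \<open>word_map_diff_le\<close>).

  Letting \<open>w\<close> run through the prefixes of the tail of \<open>\<sigma> \<in> j I\<^sup>\<infinity>\<close>, the left-hand side tends to
  \<open>\<psi>(\<sigma>) - \<phi>(\<sigma>)\<close>. Hence \<open>\<psi>(\<sigma>) - \<phi>(\<sigma>)\<close> lies within \<open>q\<^sub>j \<delta> / (1 - q) + \<epsilon>\<close> of some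
  \<open>\<Delta>\<^sub>j(y)\<close> with \<open>y \<in> V\<close>, for every \<open>\<epsilon> > 0\<close> (lemma \<open>index_map_diff_approx\<close>). (B1) and
  (B2) follow by the triangle inequality and \<open>\<epsilon> \<rightarrow> 0\<close>.
\<close>

text \<open>The infimum in the definition of \<^const>\<open>Lip\<close> is attained, because each inequality
  \<open>dist (f x) (f y) \<le> C * dist x y\<close> is a closed condition on \<open>C\<close>.\<close>

lemma lipschitz_on_Lip:
  assumes "C-lipschitz_on UNIV f"
  shows "(Lip f)-lipschitz_on UNIV f"
proof (rule lipschitz_onI)
  have ne: "{C. C-lipschitz_on UNIV f} \<noteq> {}"
    using assms by auto
  show "0 \<le> Lip f"
    unfolding Lip_def using ne by (rule cInf_greatest) (auto dest: lipschitz_on_nonneg)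
  show "dist (f x) (f y) \<le> Lip f * dist x y" for x y
  proof (cases "x = y")
    case False
    then have "dist (f x) (f y) / dist x y \<le> Lip f"
      unfolding Lip_def using ne
      by (intro cInf_greatest) (auto simp: divide_le_eq dest: lipschitz_onD)
    with False show ?thesis
      by (simp add: divide_le_eq)
  qed simp
qed

lemma word_map_append: "word_map S (v @ w) x = word_map S v (word_map S w x)"
  by (simp add: word_map_def)

lemma word_map_in:
  assumes "\<And>i. i \<in> I \<Longrightarrow> S i ` V \<subseteq> V" "set w \<subseteq> I" "x \<in> V"
  shows "word_map S w x \<in> V"
  using assms(2) by (induction w) (use assms(1,3) in \<open>auto simp: word_map_def\<close>)

lemma lipschitz_on_word_map:
  assumes "\<And>i. i \<in> set w \<Longrightarrow> (Lip (S i))-lipschitz_on UNIV (S i)"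
  shows "(word_ratio S w)-lipschitz_on UNIV (word_map S w)"
  using assms
proof (induction w)
  case Nil
  show ?case by (simp add: word_map_def word_ratio_def lipschitz_on_def)
next
  case (Cons i w)
  then have "(Lip (S i))-lipschitz_on (word_map S w ` UNIV) (S i)"
    by (auto intro: lipschitz_on_subset)
  from lipschitz_on_compose[OF Cons.IH this] Cons.prems show ?case
    by (simp add: word_map_def word_ratio_def comp_def mult.commute)
qed

text \<open>For a new first letter \<open>i\<close>, inserting \<open>S\<^sub>i(T\<^sub>w(x))\<close> gives an error of at most \<open>\<delta>\<close>, since
  \<open>T\<^sub>w(x) \<in> V\<close>, plus \<open>q\<close> times the previous error; \<open>\<delta> / (1 - q)\<close> reproduces
  itself in this step.\<close>

lemma word_map_diff_le:
  fixes S T :: "'i \<Rightarrow> 'a::real_normed_vector \<Rightarrow> 'a"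
  assumes lip: "\<And>i. i \<in> I \<Longrightarrow> q-lipschitz_on UNIV (S i)" and "q < 1"
    and TV: "\<And>i. i \<in> I \<Longrightarrow> T i ` V \<subseteq> V"
    and \<delta>: "\<And>i x. i \<in> I \<Longrightarrow> x \<in> V \<Longrightarrow> norm (T i x - S i x) \<le> \<delta>" and "0 \<le> \<delta>"
    and "set w \<subseteq> I" "x \<in> V"
  shows "norm (word_map T w x - word_map S w x) \<le> \<delta> / (1 - q)"
  using \<open>set w \<subseteq> I\<close>
proof (induction w)
  case Nil
  show ?case using \<open>0 \<le> \<delta>\<close> \<open>q < 1\<close> by (simp add: word_map_def)
next
  case (Cons i w)
  let ?y = "word_map T w x" and ?z = "word_map S w x"
  have i: "i \<in> I" and "?y \<in> V"
    using Cons.prems \<open>x \<in> V\<close> by (auto intro!: word_map_in[where I = I] TV)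
  have "norm (T i ?y - S i ?z) \<le> norm (T i ?y - S i ?y) + norm (S i ?y - S i ?z)"
    using norm_triangle_ineq[of "T i ?y - S i ?y" "S i ?y - S i ?z"] by simp
  also have "\<dots> \<le> \<delta> + q * norm (?y - ?z)"
    using \<delta>[OF i \<open>?y \<in> V\<close>] lipschitz_onD[OF lip[OF i], of ?y ?z] by (simp add: dist_norm)
  also have "\<dots> \<le> \<delta> + q * (\<delta> / (1 - q))"
    using Cons lipschitz_on_nonneg[OF lip[OF i]] by (intro add_left_mono mult_left_mono) auto
  also have "\<dots> = \<delta> / (1 - q)"
    using \<open>q < 1\<close> by (simp add: field_simps)
  finally show ?case by (simp add: word_map_def)
qed

text \<open>This is the splitting applied to long prefixes of \<open>\<sigma>\<close>. The arbitrary slack \<open>\<epsilon>\<close> keeps \<open>y\<close> in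
  \<open>V\<close>; a limit point of the \<open>y\<close> would in general lie only in the closure of \<open>V\<close>.\<close>

lemma index_map_diff_approx:
  fixes S T :: "'i \<Rightarrow> 'a::banach \<Rightarrow> 'a"
  assumes "finite I"
    and S: "\<And>i. i \<in> I \<Longrightarrow> contraction (S i)" and T: "\<And>i. i \<in> I \<Longrightarrow> contraction (T i)"
    and q: "\<And>i. i \<in> I \<Longrightarrow> Lip (S i) \<le> q" "q < 1"
    and "V \<noteq> {}" and TV: "\<And>i. i \<in> I \<Longrightarrow> T i ` V \<subseteq> V"
    and \<delta>: "\<And>i x. i \<in> I \<Longrightarrow> x \<in> V \<Longrightarrow> norm (T i x - S i x) \<le> \<delta>" and "0 \<le> \<delta>"
    and \<sigma>: "\<sigma> \<in> cylinder I j" and "0 < \<epsilon>"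
  obtains y where "y \<in> V"
    "norm ((index_map T \<sigma> - index_map S \<sigma>) - (word_map T j y - word_map S j y))
      \<le> word_ratio S j * \<delta> / (1 - q) + \<epsilon>"
proof -
  obtain x where x: "x \<in> V" using \<open>V \<noteq> {}\<close> by auto
  have lip: "(Lip (S i))-lipschitz_on UNIV (S i)" if "i \<in> I" for i
    using contraction_lipschitz[OF S[OF that]] lipschitz_on_Lip by blast
  have \<sigma>I: "\<sigma> \<in> streams I" and j: "stake (length j) \<sigma> = j"
    using \<sigma> by (auto simp: cylinder_def)
  have I: "set (stake n \<sigma>') \<subseteq> I" if "\<sigma>' \<in> streams I" for n \<sigma>'
    using that by (auto simp: streams_iff_snth set_conv_nth)
  let ?\<Delta> = "\<lambda>w x. word_map T w x - word_map S w x"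
  have "(\<lambda>n. ?\<Delta> (stake n \<sigma>) x) \<longlonglongrightarrow> index_map T \<sigma> - index_map S \<sigma>"
    by (intro tendsto_diff index_map_tendsto[OF \<open>finite I\<close>] S T \<sigma>I)
  from LIMSEQ_D[OF this \<open>0 < \<epsilon>\<close>] obtain N
    where N: "\<And>n. n \<ge> N \<Longrightarrow>
      norm (?\<Delta> (stake n \<sigma>) x - (index_map T \<sigma> - index_map S \<sigma>)) < \<epsilon>"
    by blast
  define w where "w = stake N (sdrop (length j) \<sigma>)"
  have w: "set w \<subseteq> I"
    unfolding w_def using \<sigma>I by (intro I) (auto simp: streams_iff_snth sdrop_snth)
  have jw: "stake (length j + N) \<sigma> = j @ w"
    unfolding w_def by (subst j[symmetric]) (simp add: stake_add[symmetric] j)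
  let ?y = "word_map T w x" and ?z = "word_map S w x"
  have y: "?y \<in> V" by (rule word_map_in[OF TV w x])
  have j_lip: "(word_ratio S j)-lipschitz_on UNIV (word_map S j)"
    by (rule lipschitz_on_word_map) (use I[OF \<sigma>I, of "length j"] j lip in auto)
  have "norm (?y - ?z) \<le> \<delta> / (1 - q)"
    using lipschitz_on_mono[OF lip subset_refl q(1)] q(2) TV \<delta> \<open>0 \<le> \<delta>\<close> w x
    by (rule word_map_diff_le) auto
  then have "norm (word_map S j ?y - word_map S j ?z) \<le> word_ratio S j * (\<delta> / (1 - q))"
    using lipschitz_onD[OF j_lip, of ?y ?z] mult_left_mono[OF _ lipschitz_on_nonneg[OF j_lip]]
    unfolding dist_norm by (meson UNIV_I order_trans)
  moreover have "?\<Delta> (j @ w) x = ?\<Delta> j ?y + (word_map S j ?y - word_map S j ?z)"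
    by (simp add: word_map_append)
  moreover have "norm (?\<Delta> (j @ w) x - (index_map T \<sigma> - index_map S \<sigma>)) < \<epsilon>"
    using N[of "length j + N"] by (simp add: jw)
  ultimately have "norm ((index_map T \<sigma> - index_map S \<sigma>) - ?\<Delta> j ?y)
      \<le> word_ratio S j * (\<delta> / (1 - q)) + \<epsilon>"
    using norm_triangle_ineq4[of "word_map S j ?y - word_map S j ?z"
        "?\<Delta> (j @ w) x - (index_map T \<sigma> - index_map S \<sigma>)"]
    by (simp add: algebra_simps)
  with y show thesis by (intro that[of ?y]) auto
qed

text \<open>Passing to the limit \<open>\<epsilon> \<rightarrow> 0\<close> turns the strict bounds on the approximants into weak
  ones.\<close>

lemma norm_bounds_of_approx:
  fixes d :: "'a::real_normed_vector"
  assumes "\<And>\<epsilon>. 0 < \<epsilon> \<Longrightarrow> \<exists>u. a < norm u \<and> norm u < b \<and> norm (d - u) \<le> r + \<epsilon>"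
  shows "a - r \<le> norm d \<and> norm d \<le> b + r"
proof -
  have "a - r \<le> norm d + \<epsilon> \<and> norm d \<le> b + r + \<epsilon>" if "0 < \<epsilon>" for \<epsilon>
  proof -
    obtain u where "a < norm u" "norm u < b" "norm (d - u) \<le> r + \<epsilon>"
      using assms \<open>0 < \<epsilon>\<close> by blast
    then show ?thesis
      using norm_triangle_ineq2[of d u] norm_triangle_ineq3[of d u] by linarith
  qed
  then show ?thesis by (blast intro: field_le_epsilon)
qed

theorem proposition3:
  fixes S T :: "nat \<Rightarrow> 'a::banach \<Rightarrow> 'a"
    and m :: nat
    and K L V :: "'a set"
    and \<phi> \<psi> :: "nat stream \<Rightarrow> 'a"
    and q \<delta> :: real
  assumes "1 \<le> m"
    and "\<And>i. i \<in> {1..m} \<Longrightarrow> contraction (S i)"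
    and "\<And>i. i \<in> {1..m} \<Longrightarrow> contraction (T i)"
    and "q = (MAX i\<in>{1..m}. max (Lip (S i)) (Lip (T i)))"
    and "is_attractor {1..m} S K"
    and "is_attractor {1..m} T L"
    and "\<phi> = index_map S"
    and "\<psi> = index_map T"
    and "V \<noteq> {}"
    and "bounded V"
    and "\<And>i. i \<in> {1..m} \<Longrightarrow> S i ` V \<subseteq> V"
    and "\<And>i. i \<in> {1..m} \<Longrightarrow> T i ` V \<subseteq> V"
    and "\<And>i x. i \<in> {1..m} \<Longrightarrow> x \<in> V \<Longrightarrow> norm (T i x - S i x) \<le> \<delta>"
  shows
    "(\<forall>j \<in> lists {1..m}. \<forall>\<delta>\<^sub>1 \<delta>\<^sub>2.
        (\<forall>x\<in>V. \<delta>\<^sub>1 < norm (word_map T j x - word_map S j x) \<and>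
               norm (word_map T j x - word_map S j x) < \<delta>\<^sub>2) \<longrightarrow>
        \<delta>\<^sub>1 > word_ratio S j * \<delta> / (1 - q) \<longrightarrow>
        (\<forall>\<sigma> \<in> cylinder {1..m} j.
           \<delta>\<^sub>1 - word_ratio S j * \<delta> / (1 - q) \<le> norm (\<psi> \<sigma> - \<phi> \<sigma>) \<and>
           norm (\<psi> \<sigma> - \<phi> \<sigma>) \<le> \<delta>\<^sub>2 + word_ratio S j * \<delta> / (1 - q)))
     \<and>
     (\<forall>i \<in> lists {1..m}. \<forall>j \<in> lists {1..m}. \<forall>\<delta>\<^sub>1 \<delta>\<^sub>2.
        (\<forall>x\<in>V. \<forall>y\<in>V.
           \<delta>\<^sub>1 < norm ((word_map T i x - word_map S i x) - (word_map T j y - word_map S j y)) \<and>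
           norm ((word_map T i x - word_map S i x) - (word_map T j y - word_map S j y)) < \<delta>\<^sub>2) \<longrightarrow>
        \<delta>\<^sub>1 > (word_ratio S i + word_ratio S j) * \<delta> / (1 - q) \<longrightarrow>
        (\<forall>\<sigma> \<in> cylinder {1..m} i. \<forall>\<tau> \<in> cylinder {1..m} j.
           \<delta>\<^sub>1 - (word_ratio S i + word_ratio S j) * \<delta> / (1 - q)
             \<le> norm (\<psi> \<sigma> - \<phi> \<sigma> - \<psi> \<tau> + \<phi> \<tau>) \<and>
           norm (\<psi> \<sigma> - \<phi> \<sigma> - \<psi> \<tau> + \<phi> \<tau>)
             \<le> \<delta>\<^sub>2 + (word_ratio S i + word_ratio S j) * \<delta> / (1 - q)))"
proof -
  let ?I = "{1..m}"
  let ?r = "\<lambda>j. word_ratio S j * \<delta> / (1 - q)"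
  let ?\<Delta> = "\<lambda>j x. word_map T j x - word_map S j x"
  have Lip_q: "Lip (S i) \<le> q" if "i \<in> ?I" for i
  proof -
    have "max (Lip (S i)) (Lip (T i)) \<le> q"
      unfolding assms(4) using that by (intro Max_ge) auto
    then show ?thesis by simp
  qed
  have "q < 1"
    using assms(1-3) unfolding assms(4) by (subst Max_less_iff) (auto simp: contraction_def)
  obtain x where "x \<in> V" using assms(9) by auto
  then have "0 \<le> \<delta>"
    using assms(1) order_trans[OF norm_ge_zero assms(13)[of 1 x]] by simp
  have approx: "\<exists>y\<in>V. norm ((\<psi> \<sigma> - \<phi> \<sigma>) - ?\<Delta> j y) \<le> ?r j + \<epsilon>"
    if \<sigma>: "\<sigma> \<in> cylinder ?I j" and \<epsilon>: "0 < \<epsilon>" for \<sigma> j \<epsilon>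
    using index_map_diff_approx[where S = S and T = T, OF finite_atLeastAtMost assms(2,3) Lip_q
        \<open>q < 1\<close> assms(9,12,13) \<open>0 \<le> \<delta>\<close> \<sigma> \<epsilon>] assms(7,8)
    by metis
  have B1: "\<delta>\<^sub>1 - ?r j \<le> norm (\<psi> \<sigma> - \<phi> \<sigma>) \<and> norm (\<psi> \<sigma> - \<phi> \<sigma>) \<le> \<delta>\<^sub>2 + ?r j"
    if bounds: "\<forall>x\<in>V. \<delta>\<^sub>1 < norm (?\<Delta> j x) \<and> norm (?\<Delta> j x) < \<delta>\<^sub>2"
      and \<sigma>: "\<sigma> \<in> cylinder ?I j" for j \<delta>\<^sub>1 \<delta>\<^sub>2 \<sigma>
    by (rule norm_bounds_of_approx) (use approx[OF \<sigma>] bounds in blast)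
  have B2: "\<delta>\<^sub>1 - (word_ratio S i + word_ratio S j) * \<delta> / (1 - q)
        \<le> norm (\<psi> \<sigma> - \<phi> \<sigma> - \<psi> \<tau> + \<phi> \<tau>) \<and>
      norm (\<psi> \<sigma> - \<phi> \<sigma> - \<psi> \<tau> + \<phi> \<tau>)
        \<le> \<delta>\<^sub>2 + (word_ratio S i + word_ratio S j) * \<delta> / (1 - q)"
    if bounds: "\<forall>x\<in>V. \<forall>y\<in>V. \<delta>\<^sub>1 < norm (?\<Delta> i x - ?\<Delta> j y) \<and> norm (?\<Delta> i x - ?\<Delta> j y) < \<delta>\<^sub>2"
      and \<sigma>: "\<sigma> \<in> cylinder ?I i" and \<tau>: "\<tau> \<in> cylinder ?I j" for i j \<delta>\<^sub>1 \<delta>\<^sub>2 \<sigma> \<tau>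
  proof (rule norm_bounds_of_approx)
    fix \<epsilon> :: real
    assume "0 < \<epsilon>"
    then have "0 < \<epsilon> / 2" by simp
    obtain x where x: "x \<in> V" "norm ((\<psi> \<sigma> - \<phi> \<sigma>) - ?\<Delta> i x) \<le> ?r i + \<epsilon> / 2"
      using approx[OF \<sigma> \<open>0 < \<epsilon> / 2\<close>] by blast
    obtain y where y: "y \<in> V" "norm ((\<psi> \<tau> - \<phi> \<tau>) - ?\<Delta> j y) \<le> ?r j + \<epsilon> / 2"
      using approx[OF \<tau> \<open>0 < \<epsilon> / 2\<close>] by blast
    have "(\<psi> \<sigma> - \<phi> \<sigma> - \<psi> \<tau> + \<phi> \<tau>) - (?\<Delta> i x - ?\<Delta> j y)
        = ((\<psi> \<sigma> - \<phi> \<sigma>) - ?\<Delta> i x) - ((\<psi> \<tau> - \<phi> \<tau>) - ?\<Delta> j y)"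
      by simp
    then have "norm ((\<psi> \<sigma> - \<phi> \<sigma> - \<psi> \<tau> + \<phi> \<tau>) - (?\<Delta> i x - ?\<Delta> j y))
        \<le> norm ((\<psi> \<sigma> - \<phi> \<sigma>) - ?\<Delta> i x) + norm ((\<psi> \<tau> - \<phi> \<tau>) - ?\<Delta> j y)"
      by (metis norm_triangle_ineq4)
    also have "\<dots> \<le> (word_ratio S i + word_ratio S j) * \<delta> / (1 - q) + \<epsilon>"
      using x(2) y(2) by (simp add: distrib_right add_divide_distrib)
    finally show "\<exists>u. \<delta>\<^sub>1 < norm u \<and> norm u < \<delta>\<^sub>2 \<and>
        norm ((\<psi> \<sigma> - \<phi> \<sigma> - \<psi> \<tau> + \<phi> \<tau>) - u)
          \<le> (word_ratio S i + word_ratio S j) * \<delta> / (1 - q) + \<epsilon>"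
      using bounds x(1) y(1) by blast
  qed
  show ?thesis
  proof (rule conjI, goal_cases)
    case 1
    show ?case by (intro ballI allI impI) (rule B1)
  next
    case 2
    show ?case by (intro ballI allI impI) (rule B2)
  qed
qed

end
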